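(* Let $(W,\mathcal{F})$ be an opinion space with $\mathcal{F}$ countably infinite, and let $\mathscr{I}$ be a generalized legitimate inaccuracy measure on it. Suppose that $(W,\mathcal{F})$ is S-stable relative to $\mathscr{I}$ and that $\mathscr{I}(c,w)<\infty$ for each coherent credence function $c$ on $\mathcal{F}$ and each $w\in W$. Then for every credence function $c$ on $\mathcal{F}$ the following are equivalent: (1) $c$ is coherent; (2) $c$ is not strongly dominated relative to $\mathscr{I}$ (by any credence function on $\mathcal{F}$).
   Context: An opinion space is a pair $(W,\mathcal{F})$ with $W$ a nonempty set and $\mathcal{F}\subseteq\mathcal{P}(W)$. A credence function on $\mathcal{F}$ is any function $c:\mathcal{F}\to[0,1]$. An algebra over $W$ is a subset of $\mathcal{P}(W)$ containing $W$ and closed under binary unions and complements. $c$ is coherent if it extends to a finitely additive probability function (with value $1$ on $W$) on some algebra over $W$ containing $\mathcal{F}$. For $w\in W$, $v_w:\mathcal{F}\to\{0,1\}$ is given by $v_w(p)=1$ iff $w\in p$. A bounded one-dimensional Bregman divergence is a bounded function $\mathfrak{d}:[0,1]^2\to[0,\infty)$ of the form $\mathfrak{d}(x,y)=\varphi(x)-\varphi(y)-\varphi'(y)(x-y)$, where $\varphi:[0,1]\to\mathbb{R}$ is continuous and strictly convex on $[0,1]$, continuously differentiable on $(0,1)$, and $\varphi'(i):=\lim_{x\to i}\varphi'(x)$ for $i\in\{0,1\}$ (boundedness of $\mathfrak{d}$ is equivalent to these limits being finite). For countably infinite $\mathcal{F}=\{p_1,p_2,\ldots\}$ (enumerated without repetition),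 a generalized legitimate inaccuracy measure is a map $\mathscr{I}(c,w)=\sum_{i=1}^\infty a_i\,\mathfrak{d}(v_w(p_i),c(p_i))\in[0,\infty]$ ($c$ a credence function, $w\in W$), with $\mathfrak{d}$ a bounded one-dimensional Bregman divergence and $a_i\in(0,\infty)$, $\sup_i a_i<\infty$. A credence function $d$ strongly dominates $c$ relative to $\mathscr{I}$ if $\mathscr{I}(c,w)>\mathscr{I}(d,w)$ for all $w$ in the underlying set of worlds. Compactification. Fix an enumeration $p_1,p_2,\ldots$ of $\mathcal{F}$. For $f:\mathbb{N}\to\{0,1\}$ (indices $n\ge1$) put $p_n^{f(n)}=p_n$ if $f(n)=0$ and $p_n^{f(n)}=W\setminus p_n$ if $f(n)=1$. Let $S$ be the set of sequences $s=\{p_n^{f(n)}\}_{n=1}^\infty$ (determined by $f$) such that $\bigcap_{n=1}^N p_n^{f(n)}\ne\varnothing$ for every $N$ but $\bigcap_{n=1}^\infty p_n^{f(n)}=\varnothing$. Let $W^*=W\cup\{x_s:s\in S\}$, where the $x_s$ are distinct new points. For $p=p_n\in\mathcal{F}$ let $\Psi(p)=p^*=p\cup\{x_s: s\in S,\ f(n)=0\text{ for the }f\text{ determining }s\}$, and let $\mathcal{F}^*=\{p^*:p\in\mathcal{F}\}$. $(W^*,\mathcal{F}^* )$ is the compactification of $(W,\mathcal{F})$ and $\Psi:\mathcal{F}\to\mathcal{F}^*$ is a bijection. For a coherent credence function $c$ on $\mathcal{F}$, $c^*$ is the credence function on $\mathcal{F}^*$ given by $c^*(\Psi(p))=c(p)$.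 The measure $\mathscr{I}$ is also used on $(W^*,\mathcal{F}^* )$, with the same $\mathfrak{d}$ and weights: $\mathscr{I}(e,w)=\sum_i a_i\,\mathfrak{d}(v_w(p_i^* ),e(p_i^* ))$ for $e:\mathcal{F}^*\to[0,1]$, $w\in W^*$, where $v_w(p^* )=1$ iff $w\in p^*$. S-stability. $(W,\mathcal{F})$ is S-stable relative to $\mathscr{I}$ if for every coherent credence function $c$ on $\mathcal{F}$: if $c$ is strongly dominated relative to $\mathscr{I}$, then $c^*$ on $(W^*,\mathcal{F}^* )$ is strongly dominated relative to $\mathscr{I}$. *)

theory Defs
  imports "HOL-Analysis.Analysis"
begin

section \<open>Opinion spaces and credence functions\<close>

definition opinion_space :: "'w set \<Rightarrow> 'w set set \<Rightarrow> bool" where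
  "opinion_space W F \<longleftrightarrow> W \<noteq> {} \<and> F \<subseteq> Pow W"

text \<open>Functions on \<open>F\<close> are total HOL functions of which only the values on \<open>F\<close> matter.\<close>

definition credence :: "'w set set \<Rightarrow> ('w set \<Rightarrow> real) \<Rightarrow> bool" where
  "credence F c \<longleftrightarrow> (\<forall>q\<in>F. c q \<in> {0..1})"

definition fin_add_probability :: "'w set \<Rightarrow> 'w set set \<Rightarrow> ('w set \<Rightarrow> real) \<Rightarrow> bool" where
  "fin_add_probability W A P \<longleftrightarrow>
     algebra W A \<and> (\<forall>q\<in>A. 0 \<le> P q) \<and> P W = 1 \<and> Measure_Space.additive A P"

definition coherent :: "'w set \<Rightarrow> 'w set set \<Rightarrow> ('w set \<Rightarrow> real) \<Rightarrow> bool" where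
  "coherent W F c \<longleftrightarrow>
     credence F c \<and> (\<exists>A P. F \<subseteq> A \<and> fin_add_probability W A P \<and> (\<forall>q\<in>F. P q = c q))"

definition truth_value :: "'w \<Rightarrow> 'w set \<Rightarrow> real" where
  "truth_value w q = (if w \<in> q then 1 else 0)"

section \<open>Inaccuracy measures\<close>

definition strictly_convex_on :: "real set \<Rightarrow> (real \<Rightarrow> real) \<Rightarrow> bool" where
  "strictly_convex_on I \<phi> \<longleftrightarrow>
     (\<forall>x\<in>I. \<forall>y\<in>I. \<forall>t. x \<noteq> y \<and> 0 < t \<and> t < 1 \<longrightarrow>
        \<phi> ((1 - t) * x + t * y) < (1 - t) * \<phi> x + t * \<phi> y)"

text \<open>
  Here \<open>\<phi>'\<close> is the derivative of \<open>\<phi>\<close> on the open unit interval, extended to the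
  end points by its limits. That these are real numbers costs no generality for a bounded
  divergence. Only the values of \<open>\<dd>\<close> on the unit square matter.
\<close>

definition bounded_bregman_divergence :: "(real \<Rightarrow> real \<Rightarrow> real) \<Rightarrow> bool" where
  "bounded_bregman_divergence \<dd> \<longleftrightarrow>
     (\<forall>x\<in>{0..1}. \<forall>y\<in>{0..1}. 0 \<le> \<dd> x y) \<and>
     (\<exists>B. \<forall>x\<in>{0..1}. \<forall>y\<in>{0..1}. \<dd> x y \<le> B) \<and>
     (\<exists>\<phi> \<phi>'.
        continuous_on {0..1} \<phi> \<and>
        strictly_convex_on {0..1} \<phi> \<and>
        (\<forall>x\<in>{0<..<1}. (\<phi> has_real_derivative \<phi>' x) (at x)) \<and>
        continuous_on {0<..<1} \<phi>' \<and>
        (\<phi>' \<longlongrightarrow> \<phi>' 0) (at_right 0) \<and>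
        (\<phi>' \<longlongrightarrow> \<phi>' 1) (at_left 1) \<and>
        (\<forall>x\<in>{0..1}. \<forall>y\<in>{0..1}. \<dd> x y = \<phi> x - \<phi> y - \<phi>' y * (x - y)))"

text \<open>
  The data of a generalized legitimate inaccuracy measure are \<open>\<dd>\<close>, the weights \<open>a\<close> and
  the enumeration \<open>p\<close> of the propositions; enumerations are indexed from \<open>0\<close>.
\<close>

definition legitimate :: "(real \<Rightarrow> real \<Rightarrow> real) \<Rightarrow> (nat \<Rightarrow> real) \<Rightarrow> bool" where
  "legitimate \<dd> a \<longleftrightarrow>
     bounded_bregman_divergence \<dd> \<and> (\<forall>i. 0 < a i) \<and> bdd_above (range a)"

definition inaccuracy ::
  "(real \<Rightarrow> real \<Rightarrow> real) \<Rightarrow> (nat \<Rightarrow> real) \<Rightarrow> (nat \<Rightarrow> 'w set) \<Rightarrow> ('w set \<Rightarrow> real) \<Rightarrow> 'w \<Rightarrow> ennreal"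
where
  "inaccuracy \<dd> a p c w = (\<Sum>i. ennreal (a i * \<dd> (truth_value w (p i)) (c (p i))))"

definition strongly_dominates ::
  "'w set \<Rightarrow> (('w set \<Rightarrow> real) \<Rightarrow> 'w \<Rightarrow> ennreal) \<Rightarrow> ('w set \<Rightarrow> real) \<Rightarrow> ('w set \<Rightarrow> real) \<Rightarrow> bool"
where
  "strongly_dominates W \<I> d c \<longleftrightarrow> (\<forall>w\<in>W. \<I> c w > \<I> d w)"

definition strongly_dominated ::
  "'w set \<Rightarrow> 'w set set \<Rightarrow> (('w set \<Rightarrow> real) \<Rightarrow> 'w \<Rightarrow> ennreal) \<Rightarrow> ('w set \<Rightarrow> real) \<Rightarrow> bool"
where
  "strongly_dominated W F \<I> c \<longleftrightarrow> (\<exists>d. credence F d \<and> strongly_dominates W \<I> d c)"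

section \<open>Compactification\<close>

text \<open>
  A choice function \<open>f\<close> takes the value \<open>True\<close> at \<open>n\<close> where the complement of \<open>p n\<close> is
  chosen. The worlds of the compactification are the old worlds \<open>Inl w\<close> and, as the new point
  belonging to a sequence \<open>s\<close>, \<open>Inr s\<close>.
\<close>

type_synonym 'w cworld = "'w + (nat \<Rightarrow> 'w set)"

definition signed_seq :: "'w set \<Rightarrow> (nat \<Rightarrow> 'w set) \<Rightarrow> (nat \<Rightarrow> bool) \<Rightarrow> nat \<Rightarrow> 'w set" where
  "signed_seq W p f n = (if f n then W - p n else p n)"

definition new_seqs :: "'w set \<Rightarrow> (nat \<Rightarrow> 'w set) \<Rightarrow> (nat \<Rightarrow> 'w set) set" where
  "new_seqs W p =
     {signed_seq W p f | f.
        (\<forall>N. (\<Inter>n\<le>N. signed_seq W p f n) \<noteq> {}) \<and> (\<Inter>n. signed_seq W p f n) = {}}"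

definition compact_worlds :: "'w set \<Rightarrow> (nat \<Rightarrow> 'w set) \<Rightarrow> 'w cworld set" where
  "compact_worlds W p = Inl ` W \<union> Inr ` new_seqs W p"

definition \<Psi> :: "'w set \<Rightarrow> (nat \<Rightarrow> 'w set) \<Rightarrow> 'w set \<Rightarrow> 'w cworld set" where
  "\<Psi> W p q =
     Inl ` q \<union>
     {Inr (signed_seq W p f) | f. signed_seq W p f \<in> new_seqs W p \<and> (\<exists>n. q = p n \<and> \<not> f n)}"

definition star_credence ::
  "'w set \<Rightarrow> 'w set set \<Rightarrow> (nat \<Rightarrow> 'w set) \<Rightarrow> ('w set \<Rightarrow> real) \<Rightarrow> 'w cworld set \<Rightarrow> real"
where
  "star_credence W F p c q = c (the_inv_into F (\<Psi> W p) q)"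

lemma inj_on_Psi: "inj_on (\<Psi> W p) F"
proof (rule inj_onI)
  fix q r assume eq: "\<Psi> W p q = \<Psi> W p r"
  have "Inl -` \<Psi> W p x = x" for x
    by (auto simp: \<Psi>_def)
  with eq show "q = r" by metis
qed

lemma star_credence_Psi: "q \<in> F \<Longrightarrow> star_credence W F p c (\<Psi> W p q) = c q"
  by (simp add: star_credence_def the_inv_into_f_f inj_on_Psi)

definition S_stable ::
  "'w set \<Rightarrow> 'w set set \<Rightarrow> (nat \<Rightarrow> 'w set) \<Rightarrow> (real \<Rightarrow> real \<Rightarrow> real) \<Rightarrow> (nat \<Rightarrow> real) \<Rightarrow> bool"
where
  "S_stable W F p \<dd> a \<longleftrightarrow>
     (\<forall>c. coherent W F c \<longrightarrow>
        strongly_dominated W F (inaccuracy \<dd> a p) c \<longrightarrow>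
        strongly_dominated (compact_worlds W p) (\<Psi> W p ` F)
          (inaccuracy \<dd> a (\<lambda>i. \<Psi> W p (p i))) (star_credence W F p c))"

end

theory Submission
  imports Defs
begin

text \<open>
  Suppose \<open>c\<close> is incoherent. By compactness of the set of finitely additive
  probabilities, some finite part of \<open>c\<close> is already matched by none of them, and replacing that
  part by its Bregman projection onto this set lowers the inaccuracy at every world, provided the
  remaining tail is finite. Since all coherent credences have finite inaccuracy, the total weight of
  the propositions on which a world disagrees with a fixed one is bounded, so the inaccuracy of
  \<open>c\<close> is finite everywhere or infinite everywhere; in the latter case any truth assignment
  dominates \<open>c\<close>.

  Suppose \<open>c\<close> is coherent. A world of the compactification is a point of the closure of the truth
  assignments in the Cantor space. There, the finitely additive probability extending \<open>c\<close>
  induces a countably additive measure, and propriety applied term by term shows that no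
  credences have a smaller expected inaccuracy than \<open>c\<close>. The expected inaccuracy of \<open>c\<close> is
  finite by the bound on disagreements. Hence \<open>c\<close> is not strongly dominated on the
  compactification, and S-stability applies.
\<close>

section \<open>Bregman divergences\<close>

text \<open>The end point limits of the derivative are absorbed into continuity of \<phi>' on the
  closed interval. Together, \<open>nonneg\<close> and \<open>eq\<close> say that
  \<open>\<phi>' y\<close> is the slope of a supporting line of \<phi> at \<open>y\<close>.\<close>

locale bregman =
  fixes \<dd> :: "real \<Rightarrow> real \<Rightarrow> real" and \<phi> \<phi>' :: "real \<Rightarrow> real"
  assumes nonneg: "x \<in> {0..1} \<Longrightarrow> y \<in> {0..1} \<Longrightarrow> 0 \<le> \<dd> x y"
    and continuous_phi: "continuous_on {0..1} \<phi>"
    and continuous_phi': "continuous_on {0..1} \<phi>'"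
    and strictly_convex: "strictly_convex_on {0..1} \<phi>"
    and eq: "x \<in> {0..1} \<Longrightarrow> y \<in> {0..1} \<Longrightarrow> \<dd> x y = \<phi> x - \<phi> y - \<phi>' y * (x - y)"
begin

text \<open>At the midpoint \<open>z\<close> of \<open>x\<close> and \<open>y\<close>, \<phi> lies
  on or above its supporting line at \<open>y\<close>, but strictly below the chord from
  \<open>x\<close> to \<open>y\<close>. Doubling the gap gives \<open>\<dd> x y\<close>.\<close>

lemma pos:
  assumes x: "x \<in> {0..1}" and y: "y \<in> {0..1}" and "x \<noteq> y"
  shows "0 < \<dd> x y"
proof -
  define z where "z = (1 - 1/2) * x + (1/2) * y"
  have z: "z \<in> {0..1}" using x y by (auto simp: z_def)
  have "\<phi> z < (1 - 1/2) * \<phi> x + (1/2) * \<phi> y"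
    using strictly_convex x y \<open>x \<noteq> y\<close> unfolding strictly_convex_on_def z_def
    by (metis divide_less_eq_1 half_gt_zero less_numeral_extra(1) one_less_numeral_iff semiring_norm(76) zero_less_numeral)
  moreover have "0 \<le> \<phi> z - \<phi> y - \<phi>' y * (z - y)"
    using nonneg[OF z y] eq[OF z y] by simp
  moreover have "\<phi>' y * (z - y) = \<phi>' y * (x - y) / 2"
    by (simp add: z_def field_simps)
  ultimately show ?thesis using eq[OF x y] by simp
qed

text \<open>The law of cosines for Bregman divergences; the sign of the cross term decides every
  comparison below.\<close>

lemma three_point:
  assumes "x \<in> {0..1}" "y \<in> {0..1}" "z \<in> {0..1}"
  shows "\<dd> x z = \<dd> x y + \<dd> y z + (\<phi>' y - \<phi>' z) * (x - y)"
  using assms by (simp add: eq algebra_simps)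

lemma phi'_mono:
  assumes "x \<in> {0..1}" "y \<in> {0..1}" "x \<le> y"
  shows "\<phi>' x \<le> \<phi>' y"
proof (cases "x = y")
  case False
  have "0 \<le> \<dd> x y + \<dd> y x" using nonneg assms by simp
  also have "\<dots> = (\<phi>' y - \<phi>' x) * (y - x)" using assms by (simp add: eq algebra_simps)
  finally show ?thesis using False assms(3) by (simp add: zero_le_mult_iff)
qed simp

text \<open>Splitting \<open>\<dd> 0 y\<close> at \<open>x\<close> leaves \<open>\<dd> x y\<close>
  and the cross term \<open>x * (\<phi>' y - \<phi>' x)\<close>, both nonnegative. Together with
  \<open>one_antimono\<close>: moving a credence away from the truth value never lowers the
  penalty.\<close>

lemma zero_mono:
  assumes "x \<in> {0..1}" "y \<in> {0..1}" "x \<le> y"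
  shows "\<dd> 0 x \<le> \<dd> 0 y"
proof -
  have "0 \<le> (\<phi>' y - \<phi>' x) * x"
    using phi'_mono[OF assms] assms by simp
  then show ?thesis
    using three_point[of 0 x y] nonneg[of x y] assms by (simp add: algebra_simps)
qed

lemma one_antimono:
  assumes "x \<in> {0..1}" "y \<in> {0..1}" "x \<le> y"
  shows "\<dd> 1 y \<le> \<dd> 1 x"
proof -
  have "0 \<le> (\<phi>' y - \<phi>' x) * (1 - y)"
    using phi'_mono[OF assms] assms by simp
  then show ?thesis
    using three_point[of 1 y x] nonneg[of y x] assms by (simp add: algebra_simps)
qed

text \<open>With truth having probability \<open>x\<close>, announcing \<open>y\<close> costs
  exactly \<open>\<dd> x y\<close> more in expectation than announcing \<open>x\<close>.\<close>

lemma proper: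
  assumes "x \<in> {0..1}" "y \<in> {0..1}"
  shows "x * \<dd> 1 x + (1 - x) * \<dd> 0 x \<le> x * \<dd> 1 y + (1 - x) * \<dd> 0 y"
proof -
  have "x * \<dd> 1 y + (1 - x) * \<dd> 0 y = x * \<dd> 1 x + (1 - x) * \<dd> 0 x + \<dd> x y"
    using assms by (simp add: eq algebra_simps)
  then show ?thesis using nonneg[OF assms] by simp
qed

lemma continuous_divergence:
  assumes "y \<in> {0..1}"
  shows "continuous_on {0..1} (\<lambda>x. \<dd> x y)"
proof -
  have "continuous_on {0..1} (\<lambda>x. \<phi> x - \<phi> y - \<phi>' y * (x - y))"
    by (intro continuous_intros continuous_phi)
  then show ?thesis
    by (rule continuous_on_eq) (use assms eq in simp)
qed

text \<open>The Pythagorean inequality for a Bregman projection: if \<open>y\<close> is closest to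
  \<open>b\<close> on the segment from \<open>y\<close> to \<open>z\<close>, the divergence cannot
  initially decrease towards \<open>z\<close>, and this initial slope is the summed cross term of
  \<open>three_point\<close>.\<close>

lemma finite_sum_projection:
  fixes b y z :: "nat \<Rightarrow> real"
  assumes y: "\<And>i. y i \<in> {0..1}" and z: "\<And>i. z i \<in> {0..1}" and b: "\<And>i. b i \<in> {0..1}"
    and a: "\<And>i. 0 \<le> a i"
    and min: "\<And>t. 0 < t \<Longrightarrow> t \<le> 1 \<Longrightarrow>
      (\<Sum>i<N. a i * \<dd> (y i) (b i)) \<le> (\<Sum>i<N. a i * \<dd> ((1 - t) * y i + t * z i) (b i))"
  shows "(\<Sum>i<N. a i * \<dd> (z i) (y i)) + (\<Sum>i<N. a i * \<dd> (y i) (b i))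
           \<le> (\<Sum>i<N. a i * \<dd> (z i) (b i))"
proof -
  define s where "s t i = (1 - t) * y i + t * z i" for t i
  have s: "s t i \<in> {0..1}" if "0 \<le> t" "t \<le> 1" for t i
    using y[of i] z[of i] that convex_bound_le[of "y i" 1 "z i" "1 - t" t] by (auto simp: s_def)
  \<comment> \<open>By \<open>three_point\<close>, \<open>t * g t\<close> is the increase of the
    divergence from \<open>y\<close> to \<open>s t\<close> plus the divergence of \<open>y\<close>
    from \<open>s t\<close>. So \<open>g t\<close> bounds the difference quotient from above, and
    \<open>g 0\<close> is the cross term wanted.\<close>
  define g where "g t = (\<Sum>i<N. a i * ((\<phi>' (s t i) - \<phi>' (b i)) * (z i - y i)))" for t
  have g_nonneg: "0 \<le> g t" if t: "0 < t" "t \<le> 1" for t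
  proof -
    have st: "s t i \<in> {0..1}" for i using s t by simp
    have "0 \<le> (\<Sum>i<N. a i * \<dd> (s t i) (b i)) - (\<Sum>i<N. a i * \<dd> (y i) (b i))"
      using min[OF t] by (simp add: s_def)
    also have "\<dots> = (\<Sum>i<N. a i * (\<dd> (s t i) (b i) - \<dd> (y i) (b i)))"
      by (simp add: sum_subtractf algebra_simps)
    also have "\<dots> \<le> (\<Sum>i<N. a i * (t * ((\<phi>' (s t i) - \<phi>' (b i)) * (z i - y i))))"
    proof (intro sum_mono mult_left_mono a)
      fix i
      have "s t i - y i = t * (z i - y i)" by (simp add: s_def algebra_simps)
      moreover have "\<dd> (s t i) (b i) - \<dd> (y i) (b i) = (\<phi>' (s t i) - \<phi>' (b i)) * (s t i - y i) - \<dd> (y i) (s t i)"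
        using three_point[OF y st b, of i i i] by (simp add: algebra_simps)
      ultimately show "\<dd> (s t i) (b i) - \<dd> (y i) (b i) \<le> t * ((\<phi>' (s t i) - \<phi>' (b i)) * (z i - y i))"
        using nonneg[OF y st, of i i] by (simp only: mult.left_commute)
    qed
    also have "\<dots> = t * g t" by (simp add: g_def sum_distrib_left algebra_simps)
    finally show ?thesis using t by (simp add: zero_le_mult_iff)
  qed
  have "continuous_on {0..1} (\<lambda>t. \<phi>' (s t i))" for i
    by (rule continuous_on_compose2[OF continuous_phi'])
      (use s in \<open>auto simp: s_def intro!: continuous_intros\<close>)
  then have "continuous_on {0..1} g"
    unfolding g_def by (intro continuous_intros) auto
  then have "(g \<longlongrightarrow> g 0) (at 0 within {0..1})"
    by (simp add: continuous_on_def)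
  then have "(g \<longlongrightarrow> g 0) (at_right 0)"
    by (simp add: at_within_Icc_at_right)
  moreover have "eventually (\<lambda>t. 0 \<le> g t) (at_right 0)"
    unfolding eventually_at_right_field by (intro exI[of _ 1]) (auto intro: g_nonneg)
  ultimately have "0 \<le> g 0"
    by (intro tendsto_lowerbound) auto
  moreover have "(\<Sum>i<N. a i * \<dd> (z i) (b i)) =
      (\<Sum>i<N. a i * \<dd> (z i) (y i)) + (\<Sum>i<N. a i * \<dd> (y i) (b i)) + g 0"
    unfolding g_def sum.distrib[symmetric] distrib_left[symmetric]
    by (simp add: s_def three_point[OF z y b, symmetric])
  ultimately show ?thesis by simp
qed

end

lemma bounded_bregman_divergenceE:
  assumes "bounded_bregman_divergence \<dd>"
  obtains \<phi> \<phi>' B where "bregman \<dd> \<phi> \<phi>'"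
    and "\<And>x y. x \<in> {0..1} \<Longrightarrow> y \<in> {0..1} \<Longrightarrow> \<dd> x y \<le> B"
proof -
  from assms obtain B \<phi> \<phi>' where
    nn: "\<forall>x\<in>{0..1}. \<forall>y\<in>{0..1}. 0 \<le> \<dd> x y" and
    B: "\<forall>x\<in>{0..1}. \<forall>y\<in>{0..1}. \<dd> x y \<le> B" and
    phi: "continuous_on {0..1} \<phi>" "strictly_convex_on {0..1} \<phi>" and
    phi': "continuous_on {0<..<1} \<phi>'" "(\<phi>' \<longlongrightarrow> \<phi>' 0) (at_right 0)" "(\<phi>' \<longlongrightarrow> \<phi>' 1) (at_left 1)" and
    eq: "\<forall>x\<in>{0..1}. \<forall>y\<in>{0..1}. \<dd> x y = \<phi> x - \<phi> y - \<phi>' y * (x - y)"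
    unfolding bounded_bregman_divergence_def by blast
  have "(\<phi>' \<longlongrightarrow> \<phi>' x) (at x within {0..1})" if "x \<in> {0..1}" for x
  proof -
    from that have "x = 0 \<or> x = 1 \<or> x \<in> {0<..<1}" by auto
    then consider "x = 0" | "x = 1" | "x \<in> {0<..<1}" by blast
    then show ?thesis
    proof cases
      case 3
      then have "(\<phi>' \<longlongrightarrow> \<phi>' x) (at x)"
        using phi'(1) by (metis continuous_on_eq_continuous_at isCont_def open_greaterThanLessThan)
      then show ?thesis by (rule tendsto_within_subset) auto
    qed (use phi' in \<open>simp_all add: at_within_Icc_at_right at_within_Icc_at_left\<close>)
  qed
  then have "continuous_on {0..1} \<phi>'" by (simp add: continuous_on_def)
  with nn phi eq have "bregman \<dd> \<phi> \<phi>'" by unfold_locales auto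
  with B that show ?thesis by blast
qed

section \<open>Finitely additive probabilities and projection\<close>

lemma fin_add_probability_le_1:
  assumes "fin_add_probability W A P" "q \<in> A"
  shows "P q \<le> 1"
proof -
  interpret algebra W A using assms by (simp add: fin_add_probability_def)
  have "P (q \<union> (W - q)) = P q + P (W - q)"
    using assms by (intro additiveD) (auto simp: fin_add_probability_def)
  moreover have "q \<union> (W - q) = W" using sets_into_space assms by blast
  moreover have "0 \<le> P (W - q)" using assms by (auto simp: fin_add_probability_def)
  ultimately show ?thesis using assms by (auto simp: fin_add_probability_def)
qed

lemma truth_value_range [simp]: "truth_value w q \<in> {0..1}"
  by (simp add: truth_value_def)

text \<open>Constraining the irrelevant values outside \<open>Pow W\<close> to the unit interval makes this set
  compact in the product topology.\<close>

definition charges :: "'w set \<Rightarrow> ('w set \<Rightarrow> real) set" where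
  "charges W = {P. (\<forall>q. P q \<in> {0..1}) \<and> P W = 1 \<and>
     (\<forall>q r. q \<subseteq> W \<longrightarrow> r \<subseteq> W \<longrightarrow> q \<inter> r = {} \<longrightarrow> P (q \<union> r) = P q + P r)}"

lemma charges_range: "P \<in> charges W \<Longrightarrow> P q \<in> {0..1}"
  by (simp add: charges_def)

lemma charges_coherent:
  assumes P: "P \<in> charges W" and "F \<subseteq> Pow W" and "\<And>q. q \<in> F \<Longrightarrow> P q = c q"
  shows "coherent W F c"
proof -
  have "fin_add_probability W (Pow W) P"
    using P unfolding fin_add_probability_def
    by (auto simp: charges_def algebra_Pow Measure_Space.additive_def)
  moreover have "credence F c"
    unfolding credence_def using assms(3) charges_range[OF P] by metis
  ultimately show ?thesis using assms(2,3) unfolding coherent_def by blast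
qed

lemma truth_value_charges: "w \<in> W \<Longrightarrow> truth_value w \<in> charges W"
  by (auto simp: charges_def truth_value_def)

lemma convex_comb_charges:
  assumes P: "P \<in> charges W" and Q: "Q \<in> charges W" and t: "0 \<le> t" "t \<le> 1"
  shows "(\<lambda>q. (1 - t) * P q + t * Q q) \<in> charges W"
proof -
  have "(1 - t) * P q + t * Q q \<in> {0..1}" for q
    using charges_range[OF P, of q] charges_range[OF Q, of q] t
      convex_bound_le[of "P q" 1 "Q q" "1 - t" t] by auto
  moreover have "(1 - t) * P W + t * Q W = 1"
    using P Q by (simp add: charges_def)
  moreover have "(1 - t) * P (q \<union> r) + t * Q (q \<union> r) =
      ((1 - t) * P q + t * Q q) + ((1 - t) * P r + t * Q r)"
    if "q \<subseteq> W" "r \<subseteq> W" "q \<inter> r = {}" for q r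
  proof -
    have "P (q \<union> r) = P q + P r" "Q (q \<union> r) = Q q + Q r"
      using P Q that by (auto simp: charges_def)
    then show ?thesis by (simp add: algebra_simps)
  qed
  ultimately show ?thesis by (simp add: charges_def)
qed

text \<open>By Tychonoff the cube is compact, and each condition on a charge is a closed one
  involving at most three coordinates.\<close>

lemma compact_charges: "compact (charges W)"
proof -
  have "compactin (product_topology (\<lambda>_. euclidean) UNIV)
      (PiE UNIV (\<lambda>_. {0..1}) :: ('a set \<Rightarrow> real) set)"
    by (simp add: compactin_PiE)
  then have "compact (PiE UNIV (\<lambda>_. {0..1}) :: ('a set \<Rightarrow> real) set)"
    by (simp add: euclidean_product_topology)
  moreover have "closed ({P. P W = 1} \<inter>
      (\<Inter>(q, r)\<in>{(q, r). q \<subseteq> W \<and> r \<subseteq> W \<and> q \<inter> r = {}}. {P :: 'a set \<Rightarrow> real. P (q \<union> r) = P q + P r}))"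
    by (intro closed_Int closed_INT ballI, auto intro!: closed_Collect_eq continuous_intros)
  ultimately have "compact (PiE UNIV (\<lambda>_. {0..1}) \<inter> ({P. P W = 1} \<inter>
      (\<Inter>(q, r)\<in>{(q, r). q \<subseteq> W \<and> r \<subseteq> W \<and> q \<inter> r = {}}. {P :: 'a set \<Rightarrow> real. P (q \<union> r) = P q + P r})))"
    by (rule compact_Int_closed)
  also have "PiE UNIV (\<lambda>_. {0..1}) \<inter> ({P. P W = 1} \<inter>
      (\<Inter>(q, r)\<in>{(q, r). q \<subseteq> W \<and> r \<subseteq> W \<and> q \<inter> r = {}}. {P :: 'a set \<Rightarrow> real. P (q \<union> r) = P q + P r}))
      = charges W"
    by (auto simp: charges_def PiE_def Pi_def)
  finally show ?thesis .
qed

text \<open>If each finite initial part of the credences is matched by a charge, a charge matching all of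
  them exists by compactness; otherwise the Bregman projection onto the charges dominates.\<close>

lemma (in bregman) incoherent_partially_dominated:
  fixes p :: "nat \<Rightarrow> 'w set" and a :: "nat \<Rightarrow> real"
  assumes W: "W \<noteq> {}" and p: "range p \<subseteq> Pow W" and c: "credence (range p) c"
    and a: "\<And>i. 0 < a i" and incoherent: "\<not> coherent W (range p) c"
  obtains N P where "P \<in> charges W"
    and "\<And>w. w \<in> W \<Longrightarrow> (\<Sum>i<N. a i * \<dd> (truth_value w (p i)) (P (p i)))
          < (\<Sum>i<N. a i * \<dd> (truth_value w (p i)) (c (p i)))"
proof -
  define D where "D N P = (\<Sum>i<N. a i * \<dd> (P (p i)) (c (p i)))" for N and P :: "'w set \<Rightarrow> real"
  have c01: "c (p i) \<in> {0..1}" for i using c by (simp add: credence_def)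
  have nonempty: "charges W \<noteq> {}" using truth_value_charges W by fast
  have "\<exists>N. \<forall>P\<in>charges W. D N P \<noteq> 0"
  proof (rule ccontr)
    assume *: "\<nexists>N. \<forall>P\<in>charges W. D N P \<noteq> 0"
    have "charges W \<inter> (\<Inter>i\<in>UNIV. {P. P (p i) = c (p i)}) \<noteq> {}"
    proof (rule compact_imp_fip_image[OF compact_charges])
      show "closed {P. P (p i) = c (p i)}" for i
        by (intro closed_Collect_eq continuous_intros) auto
      fix I :: "nat set" assume "finite I"
      then obtain N where N: "I \<subseteq> {..<N}" using finite_nat_iff_bounded by blast
      from * obtain P where P: "P \<in> charges W" "D N P = 0" by blast
      have "\<forall>i\<in>{..<N}. a i * \<dd> (P (p i)) (c (p i)) = 0"
        using P nonneg[OF charges_range[OF P(1)] c01] a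
        by (subst sum_nonneg_eq_0_iff[symmetric]) (auto simp: D_def less_imp_le)
      then have "P (p i) = c (p i)" if "i < N" for i
        using pos[OF charges_range[OF P(1)] c01, of "p i" i] a[of i] that
        by (metis lessThan_iff less_irrefl mult_eq_0_iff)
      then show "charges W \<inter> (\<Inter>i\<in>I. {P. P (p i) = c (p i)}) \<noteq> {}"
        using P(1) N by blast
    qed
    then obtain P where P: "P \<in> charges W" "\<And>i. P (p i) = c (p i)" by blast
    have "coherent W (range p) c" using P(2) by (intro charges_coherent[OF P(1) p]) auto
    with incoherent show False ..
  qed
  then obtain N where N: "\<And>P. P \<in> charges W \<Longrightarrow> D N P \<noteq> 0" by blast
  have "continuous_on (charges W) (\<lambda>P. \<dd> (P (p i)) (c (p i)))" for i
    by (rule continuous_on_compose2[OF continuous_divergence[OF c01]])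
      (auto simp del: atLeastAtMost_iff intro: charges_range continuous_on_subset[OF continuous_on_product_coordinates])
  then have "continuous_on (charges W) (D N)"
    unfolding D_def by (intro continuous_intros) auto
  then obtain P where P: "P \<in> charges W" and min: "\<And>Q. Q \<in> charges W \<Longrightarrow> D N P \<le> D N Q"
    using continuous_attains_inf[OF compact_charges nonempty] by blast
  have "0 \<le> D N P"
    unfolding D_def using nonneg[OF charges_range[OF P] c01] a by (intro sum_nonneg) (simp add: less_imp_le)
  with N[OF P] have pos: "0 < D N P" by simp
  \<comment> \<open>A truth assignment is itself a charge, so the segment from \<open>P\<close> to
    it stays among the charges and minimality of \<open>P\<close> applies. The positive
    \<open>D N P\<close> is the same gain at every world.\<close>
  have projection: "(\<Sum>i<N. a i * \<dd> (truth_value w (p i)) (P (p i))) + D N P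
      \<le> (\<Sum>i<N. a i * \<dd> (truth_value w (p i)) (c (p i)))" if w: "w \<in> W" for w
    unfolding D_def
  proof (rule finite_sum_projection)
    fix t :: real assume "0 < t" "t \<le> 1"
    then show "(\<Sum>i<N. a i * \<dd> (P (p i)) (c (p i)))
        \<le> (\<Sum>i<N. a i * \<dd> ((1 - t) * P (p i) + t * truth_value w (p i)) (c (p i)))"
      using min[OF convex_comb_charges[OF P truth_value_charges[OF w], of t]] by (simp add: D_def)
  qed (use charges_range[OF P] c01 a in \<open>auto simp: less_imp_le simp del: atLeastAtMost_iff\<close>)
  show ?thesis
    by (rule that[OF P, of N]) (use pos projection in fastforce)
qed

section \<open>Disagreement between worlds\<close>

text \<open>Geometric weights make a countable mixture of worlds a charge. Wherever
  \<open>w k\<close> disagrees with a given world, the mixture is at least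
  \<open>(1/2) ^ Suc k\<close> away from the truth value at that world.\<close>

lemma half_power_mixture:
  fixes w :: "nat \<Rightarrow> 'w"
  defines "b \<equiv> \<lambda>q. \<Sum>k. (1/2) ^ Suc k * truth_value (w k) q"
  assumes w: "\<And>k. w k \<in> W"
  shows "b \<in> charges W"
    and "w k \<in> q \<Longrightarrow> (1/2) ^ Suc k \<le> b q"
    and "w k \<notin> q \<Longrightarrow> b q \<le> 1 - (1/2) ^ Suc k"
proof -
  have half: "(\<lambda>k. (1/2) ^ Suc k :: real) sums 1" by (rule power_half_series)
  have sm: "summable (\<lambda>k. (1/2) ^ Suc k * truth_value (w k) q :: real)" for q
    by (rule summable_comparison_test'[OF sums_summable[OF half], of 0])
      (auto simp: truth_value_def)
  have sm': "summable (\<lambda>k. (1/2) ^ Suc k * (1 - truth_value (w k) q) :: real)" for q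
    by (rule summable_comparison_test'[OF sums_summable[OF half], of 0])
      (auto simp: truth_value_def)
  have compl: "(\<Sum>k. (1/2) ^ Suc k * (1 - truth_value (w k) q)) = 1 - b q" for q
    using suminf_diff[OF sums_summable[OF half] sm[of q]] sums_unique[OF half]
    unfolding b_def right_diff_distrib by simp
  have ge: "(1/2) ^ Suc k * truth_value (w k) q \<le> b q" for k q
    using sum_le_suminf[OF sm[of q], of "{k}"] by (simp add: b_def truth_value_def)
  have le: "(1/2) ^ Suc k * (1 - truth_value (w k) q) \<le> 1 - b q" for k q
    using sum_le_suminf[OF sm'[of q], of "{k}"] compl[of q] by (simp add: truth_value_def)
  show "w k \<in> q \<Longrightarrow> (1/2) ^ Suc k \<le> b q" using ge[of k q] by (simp add: truth_value_def)
  show "w k \<notin> q \<Longrightarrow> b q \<le> 1 - (1/2) ^ Suc k" using le[of k q] by (simp add: truth_value_def)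
  have "0 \<le> b q" for q
    unfolding b_def by (intro suminf_nonneg sm) (simp add: truth_value_def)
  moreover have "0 \<le> 1 - b q" for q
    unfolding compl[symmetric] by (intro suminf_nonneg sm') (simp add: truth_value_def)
  moreover have "b W = 1"
    using sums_unique[OF half] w by (simp add: b_def truth_value_def)
  moreover have "b (q \<union> r) = b q + b r" if "q \<inter> r = {}" for q r
  proof -
    have "truth_value x (q \<union> r) = truth_value x q + truth_value x r" for x
      using that by (auto simp: truth_value_def)
    then show ?thesis
      using suminf_add[OF sm[of q] sm[of r]] unfolding b_def by (simp add: distrib_left del: power_Suc)
  qed
  ultimately show "b \<in> charges W" by (simp add: charges_def)
qed

definition disagreement :: "(nat \<Rightarrow> real) \<Rightarrow> (nat \<Rightarrow> 'w set) \<Rightarrow> 'w \<Rightarrow> 'w \<Rightarrow> ennreal" where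
  "disagreement a p w w' = (\<Sum>i. ennreal (if (w \<in> p i) = (w' \<in> p i) then 0 else a i))"

text \<open>If the disagreement with \<open>w\<close> were unbounded, a mixture of worlds of rapidly growing
  disagreement would be coherent with infinite inaccuracy at \<open>w\<close>.\<close>

lemma (in bregman) disagreement_bounded:
  assumes w: "w \<in> W" and p: "range p \<subseteq> Pow W" and a: "\<And>i. 0 < a i"
    and fin: "\<And>b. coherent W (range p) b \<Longrightarrow> inaccuracy \<dd> a p b w < \<infinity>"
  obtains M where "0 \<le> M" and "\<And>w'. w' \<in> W \<Longrightarrow> disagreement a p w w' \<le> ennreal M"
proof (cases "\<exists>M\<ge>0. \<forall>w'\<in>W. disagreement a p w w' \<le> ennreal M")
  case False
  define l :: "nat \<Rightarrow> real" where "l k = (1/2) ^ Suc k" for k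
  have l: "0 < l k" "l k < 1" for k by (simp_all add: l_def power_Suc_less_one del: power_Suc)
  \<comment> \<open>A lower bound for the penalty of the mixture at \<open>w\<close> on any
    proposition where \<open>v k\<close> disagrees with \<open>w\<close>.\<close>
  define \<delta> where "\<delta> k = min (\<dd> 0 (l k)) (\<dd> 1 (1 - l k))" for k
  have \<delta>: "0 < \<delta> k" for k
    using pos[of 0 "l k"] pos[of 1 "1 - l k"] l[of k] by (simp add: \<delta>_def)
  \<comment> \<open>Disagreement above \<open>k / \<delta> k\<close> makes up for the shrinking
    penalty: the single component \<open>v k\<close> already forces inaccuracy at least
    \<open>k\<close>.\<close>
  have "\<exists>w'\<in>W. ennreal (k / \<delta> k) < disagreement a p w w'" for k :: nat
    using False \<delta>[of k] by (meson divide_nonneg_pos not_less of_nat_0_le_iff)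
  then obtain v where v: "\<And>k. v k \<in> W" "\<And>k. ennreal (k / \<delta> k) < disagreement a p w (v k)"
    by metis
  define b where "b q = (\<Sum>k. (1/2) ^ Suc k * truth_value (v k) q)" for q
  note mixture = half_power_mixture[where w = v and W = W, folded b_def l_def, OF v(1)]
  have b01: "b q \<in> {0..1}" for q using mixture(1) by (rule charges_range)
  have "ennreal k \<le> inaccuracy \<dd> a p b w" for k :: nat
  proof -
    have "ennreal k = ennreal (\<delta> k) * ennreal (k / \<delta> k)"
      using \<delta>[of k] by (simp flip: ennreal_mult add: less_imp_le)
    also have "\<dots> \<le> ennreal (\<delta> k) * disagreement a p w (v k)"
      using v(2)[of k] by (intro mult_left_mono) auto
    also have "\<dots> = (\<Sum>i. ennreal (\<delta> k) * ennreal (if (w \<in> p i) = (v k \<in> p i) then 0 else a i))"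
      by (simp add: disagreement_def)
    also have "\<dots> \<le> inaccuracy \<dd> a p b w"
      unfolding inaccuracy_def
    proof (rule suminf_le)
      fix i
      have "\<delta> k \<le> \<dd> (truth_value w (p i)) (b (p i))" if "(w \<in> p i) \<noteq> (v k \<in> p i)"
      proof (cases "w \<in> p i")
        case True
        then have "\<dd> 1 (1 - l k) \<le> \<dd> 1 (b (p i))"
          using mixture(3)[of k "p i"] that b01[of "p i"] l[of k] by (intro one_antimono) auto
        then show ?thesis using True by (simp add: truth_value_def \<delta>_def)
      next
        case False
        then have "\<dd> 0 (l k) \<le> \<dd> 0 (b (p i))"
          using mixture(2)[of k "p i"] that b01[of "p i"] l[of k] by (intro zero_mono) auto
        then show ?thesis using False by (simp add: truth_value_def \<delta>_def)
      qed
      then show "ennreal (\<delta> k) * ennreal (if (w \<in> p i) = (v k \<in> p i) then 0 else a i)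
          \<le> ennreal (a i * \<dd> (truth_value w (p i)) (b (p i)))"
        using a[of i] \<delta>[of k]
        by (auto simp flip: ennreal_mult simp: less_imp_le mult.commute intro!: ennreal_leI mult_left_mono)
    qed auto
    finally show ?thesis .
  qed
  then have "inaccuracy \<dd> a p b w = \<infinity>"
    by (metis ennreal_of_nat_eq_real_of_nat ennreal_Ex_less_of_nat infinity_ennreal_def leD less_top)
  moreover have "coherent W (range p) b"
    using mixture(1) p by (rule charges_coherent) simp
  ultimately show ?thesis using fin[of b] by simp
qed (use that in blast)

text \<open>Terms on which the two worlds agree coincide; any other term at \<open>w'\<close> is at
  most \<open>a i * B\<close>.\<close>

lemma (in bregman) inaccuracy_le_disagreement:
  assumes B: "\<And>x y. x \<in> {0..1} \<Longrightarrow> y \<in> {0..1} \<Longrightarrow> \<dd> x y \<le> B"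
    and c: "credence (range p) c" and a: "\<And>i. 0 < a i"
  shows "inaccuracy \<dd> a p c w' \<le> inaccuracy \<dd> a p c w + ennreal B * disagreement a p w w'"
proof -
  have c01: "c (p i) \<in> {0..1}" for i using c by (simp add: credence_def)
  have B0: "0 \<le> B" using B[of 0 0] nonneg[of 0 0] by simp
  have "inaccuracy \<dd> a p c w' \<le> (\<Sum>i. ennreal (a i * \<dd> (truth_value w (p i)) (c (p i)))
      + ennreal B * ennreal (if (w \<in> p i) = (w' \<in> p i) then 0 else a i))"
    unfolding inaccuracy_def
  proof (rule suminf_le)
    fix i
    have "a i * \<dd> (truth_value w' (p i)) (c (p i)) \<le> a i * \<dd> (truth_value w (p i)) (c (p i))
      + B * (if (w \<in> p i) = (w' \<in> p i) then 0 else a i)"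
    proof (cases "(w \<in> p i) = (w' \<in> p i)")
      case False
      have "a i * \<dd> (truth_value w' (p i)) (c (p i)) \<le> a i * B"
        using a[of i] B[OF truth_value_range c01] by simp
      moreover have "0 \<le> a i * \<dd> (truth_value w (p i)) (c (p i))"
        by (intro mult_nonneg_nonneg nonneg truth_value_range c01 less_imp_le a)
      ultimately show ?thesis using False by (simp add: mult.commute)
    qed (simp add: truth_value_def)
    then show "ennreal (a i * \<dd> (truth_value w' (p i)) (c (p i)))
        \<le> ennreal (a i * \<dd> (truth_value w (p i)) (c (p i)))
          + ennreal B * ennreal (if (w \<in> p i) = (w' \<in> p i) then 0 else a i)"
      using a[of i] nonneg[OF truth_value_range c01, of w "p i" i] B0
      by (auto simp flip: ennreal_mult ennreal_plus intro!: ennreal_leI)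
  qed auto
  then show ?thesis
    by (simp add: suminf_add[symmetric] inaccuracy_def disagreement_def)
qed

lemma (in bregman) incoherent_strongly_dominated:
  assumes W: "W \<noteq> {}" and p: "inj p" "range p \<subseteq> Pow W" and a: "\<And>i. 0 < a i"
    and B: "\<And>x y. x \<in> {0..1} \<Longrightarrow> y \<in> {0..1} \<Longrightarrow> \<dd> x y \<le> B"
    and fin: "\<And>b w. coherent W (range p) b \<Longrightarrow> w \<in> W \<Longrightarrow> inaccuracy \<dd> a p b w < \<infinity>"
    and c: "credence (range p) c" and incoherent: "\<not> coherent W (range p) c"
  shows "strongly_dominated W (range p) (inaccuracy \<dd> a p) c"
proof (cases "\<exists>w\<in>W. inaccuracy \<dd> a p c w < \<infinity>")
  case True
  then obtain w0 where w0: "w0 \<in> W" "inaccuracy \<dd> a p c w0 < \<infinity>" by blast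
  obtain M where M: "0 \<le> M" "\<And>w'. w' \<in> W \<Longrightarrow> disagreement a p w0 w' \<le> ennreal M"
    using disagreement_bounded[OF w0(1) p(2) a fin[OF _ w0(1)]] by blast
  \<comment> \<open>Finiteness spreads from \<open>w0\<close> to all worlds. It is required because
    adding an infinite tail would destroy the strict gain on the initial part.\<close>
  have c_fin: "inaccuracy \<dd> a p c w < \<infinity>" if "w \<in> W" for w
  proof -
    have "inaccuracy \<dd> a p c w \<le> inaccuracy \<dd> a p c w0 + ennreal B * disagreement a p w0 w"
      by (rule inaccuracy_le_disagreement[OF B c a])
    also have "\<dots> \<le> inaccuracy \<dd> a p c w0 + ennreal B * ennreal M"
      using M(2)[OF that] by (intro add_left_mono mult_left_mono) auto
    also have "\<dots> < \<infinity>" using w0(2) by (simp add: ennreal_mult_less_top)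
    finally show ?thesis .
  qed
  obtain N P where P: "P \<in> charges W" and less:
    "\<And>w. w \<in> W \<Longrightarrow> (\<Sum>i<N. a i * \<dd> (truth_value w (p i)) (P (p i)))
          < (\<Sum>i<N. a i * \<dd> (truth_value w (p i)) (c (p i)))"
    using incoherent_partially_dominated[where p = p and a = a, OF W p(2) c a incoherent] by blast
  \<comment> \<open>Only the first \<open>N\<close> propositions are changed; injectivity of
    \<open>p\<close> keeps the tail terms equal to those of \<open>c\<close>.\<close>
  define d where "d q = (if q \<in> p ` {..<N} then P q else c q)" for q
  have d_p: "d (p i) = (if i < N then P (p i) else c (p i))" for i
    using p(1) by (auto simp: d_def dest: injD)
  have d: "credence (range p) d"
    using c charges_range[OF P] by (simp add: credence_def d_def)
  have split: "inaccuracy \<dd> a p b w = (\<Sum>i. ennreal (a (i + N) * \<dd> (truth_value w (p (i + N))) (b (p (i + N)))))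
      + ennreal (\<Sum>i<N. a i * \<dd> (truth_value w (p i)) (b (p i)))"
    if "credence (range p) b" for b w
  proof -
    have "0 \<le> a i * \<dd> (truth_value w (p i)) (b (p i))" for i
      using a[of i] that nonneg[OF truth_value_range, of "b (p i)" w "p i"] by (simp add: credence_def)
    then show ?thesis
      unfolding inaccuracy_def by (subst suminf_offset[of _ N]) (simp_all add: sum_ennreal)
  qed
  have "inaccuracy \<dd> a p d w < inaccuracy \<dd> a p c w" if w: "w \<in> W" for w
  proof -
    have "(\<Sum>i. ennreal (a (i + N) * \<dd> (truth_value w (p (i + N))) (c (p (i + N))))) < top"
      using c_fin[OF w] split[OF c, of w] by simp
    moreover have "ennreal (\<Sum>i<N. a i * \<dd> (truth_value w (p i)) (d (p i)))
        < ennreal (\<Sum>i<N. a i * \<dd> (truth_value w (p i)) (c (p i)))"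
    proof (rule ennreal_lessI)
      have "0 \<le> (\<Sum>i<N. a i * \<dd> (truth_value w (p i)) (P (p i)))"
        by (intro sum_nonneg mult_nonneg_nonneg nonneg truth_value_range charges_range[OF P] less_imp_le a)
      with less[OF w] show "0 < (\<Sum>i<N. a i * \<dd> (truth_value w (p i)) (c (p i)))" by simp
      show "(\<Sum>i<N. a i * \<dd> (truth_value w (p i)) (d (p i))) < (\<Sum>i<N. a i * \<dd> (truth_value w (p i)) (c (p i)))"
        using less[OF w] by (simp add: d_p)
    qed
    moreover have "d (p (i + N)) = c (p (i + N))" for i by (simp add: d_p)
    ultimately show ?thesis
      unfolding split[OF c] split[OF d] by (simp only: ennreal_add_left_cancel_less) simp
  qed
  with d show ?thesis by (auto simp: strongly_dominated_def strongly_dominates_def)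
next
  case False
  \<comment> \<open>Here \<open>c\<close> has infinite inaccuracy everywhere, while a truth
    assignment is coherent and thus has finite inaccuracy at every world.\<close>
  obtain w0 where w0: "w0 \<in> W" using W by blast
  have "coherent W (range p) (truth_value w0)"
    using truth_value_charges[OF w0] p(2) by (rule charges_coherent) simp
  then have "strongly_dominates W (inaccuracy \<dd> a p) (truth_value w0) c"
    using fin False by (fastforce simp: strongly_dominates_def not_less)
  moreover have "credence (range p) (truth_value w0)"
    unfolding credence_def by (intro ballI truth_value_range)
  ultimately show ?thesis
    unfolding strongly_dominated_def by blast
qed

section \<open>Countably additive extension on the Cantor space\<close>

definition cylinders :: "(nat \<Rightarrow> bool) set set" where
  "cylinders = {E. \<exists>N. \<forall>x y. (\<forall>n<N. x n = y n) \<longrightarrow> (x \<in> E \<longleftrightarrow> y \<in> E)}"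

lemma cylindersI: "(\<And>x y. (\<And>n. n < N \<Longrightarrow> x n = y n) \<Longrightarrow> x \<in> E \<longleftrightarrow> y \<in> E) \<Longrightarrow> E \<in> cylinders"
  unfolding cylinders_def by blast

lemma coordinate_cylinder: "{x. x n} \<in> cylinders"
  by (rule cylindersI[of "Suc n"]) auto

lemma algebra_cylinders: "algebra UNIV cylinders"
  unfolding algebra_iff_Un
proof (intro conjI ballI)
  show "{} \<in> cylinders" by (rule cylindersI) auto
  fix E assume "E \<in> cylinders"
  then obtain N where N: "\<And>x y. (\<And>n. n < N \<Longrightarrow> x n = y n) \<Longrightarrow> x \<in> E \<longleftrightarrow> y \<in> E"
    unfolding cylinders_def by blast
  then show "UNIV - E \<in> cylinders" by (intro cylindersI[of N]) blast
  fix E' assume "E' \<in> cylinders"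
  then obtain N' where N': "\<And>x y. (\<And>n. n < N' \<Longrightarrow> x n = y n) \<Longrightarrow> x \<in> E' \<longleftrightarrow> y \<in> E'"
    unfolding cylinders_def by blast
  show "E \<union> E' \<in> cylinders"
  proof (rule cylindersI[of "max N N'"])
    fix x y :: "nat \<Rightarrow> bool" assume "\<And>n. n < max N N' \<Longrightarrow> x n = y n"
    then have "x \<in> E \<longleftrightarrow> y \<in> E" "x \<in> E' \<longleftrightarrow> y \<in> E'" by (auto intro!: N N')
    then show "x \<in> E \<union> E' \<longleftrightarrow> y \<in> E \<union> E'" by simp
  qed
qed simp

text \<open>Induction on the number of determining coordinates: split on the last one and fix its
  value in each half. It serves as an induction principle for properties of cylinders closed under
  Boolean operations.\<close>

lemma cylinders_subset_algebra:
  assumes "algebra UNIV X" and coord: "\<And>n. {x. x n} \<in> X"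
  shows "cylinders \<subseteq> X"
proof -
  interpret algebra UNIV X by fact
  have "E \<in> X" if "\<forall>x y. (\<forall>n<N. x n = y n) \<longrightarrow> (x \<in> E \<longleftrightarrow> y \<in> E)" for N E
    using that
  proof (induction N arbitrary: E)
    case 0
    then have "E = {} \<or> E = UNIV" by auto
    then show ?case using top by auto
  next
    case (Suc N)
    have "{x. x(N := b) \<in> E} \<in> X" for b
    proof (rule Suc.IH, intro allI impI)
      fix x y :: "nat \<Rightarrow> bool" assume "\<forall>n<N. x n = y n"
      then have "\<forall>n<Suc N. (x(N := b)) n = (y(N := b)) n" by (auto simp: less_Suc_eq)
      with Suc.prems show "x \<in> {x. x(N := b) \<in> E} \<longleftrightarrow> y \<in> {x. x(N := b) \<in> E}" by blast
    qed
    then have "({x. x N} \<inter> {x. x(N := True) \<in> E}) \<union> ((UNIV - {x. x N}) \<inter> {x. x(N := False) \<in> E}) \<in> X"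
      using coord by (intro Un Int compl_sets)
    also have "({x. x N} \<inter> {x. x(N := True) \<in> E}) \<union> ((UNIV - {x. x N}) \<inter> {x. x(N := False) \<in> E}) = E"
    proof (rule set_eqI)
      fix x :: "nat \<Rightarrow> bool"
      have "x N \<Longrightarrow> x(N := True) = x" "\<not> x N \<Longrightarrow> x(N := False) = x"
        by (simp_all add: fun_upd_idem_iff)
      then show "x \<in> ({x. x N} \<inter> {x. x(N := True) \<in> E}) \<union> ((UNIV - {x. x N}) \<inter> {x. x(N := False) \<in> E}) \<longleftrightarrow> x \<in> E"
        by (cases "x N") simp_all
    qed
    finally show ?case .
  qed
  then show ?thesis unfolding cylinders_def by blast
qed

lemma closed_cylinder:
  assumes "E \<in> cylinders"
  shows "closed E"
proof -
  have "algebra UNIV {E :: (nat \<Rightarrow> bool) set. open E \<and> closed E}"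
    unfolding algebra_iff_Un by (auto simp: Compl_eq_Diff_UNIV[symmetric] closed_open)
  moreover have "{x :: nat \<Rightarrow> bool. x n} \<in> {E. open E \<and> closed E}" for n
  proof -
    have "open ((\<lambda>x :: nat \<Rightarrow> bool. x n) -` {True})" "closed ((\<lambda>x :: nat \<Rightarrow> bool. x n) -` {True})"
      by (auto intro!: open_vimage closed_vimage open_discrete)
    then show ?thesis by (simp add: vimage_def)
  qed
  ultimately show ?thesis using cylinders_subset_algebra assms by fastforce
qed

lemma compact_bool_sequences: "compact (UNIV :: (nat \<Rightarrow> bool) set)"
proof -
  have "compactin (product_topology (\<lambda>_. euclidean) UNIV) (PiE UNIV (\<lambda>_. UNIV) :: (nat \<Rightarrow> bool) set)"
    by (subst compactin_PiE) (simp add: finite_imp_compact)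
  then show ?thesis by (simp add: euclidean_product_topology PiE_UNIV_domain)
qed

definition valuation :: "(nat \<Rightarrow> 'w set) \<Rightarrow> 'w \<Rightarrow> nat \<Rightarrow> bool" where
  "valuation p w = (\<lambda>n. w \<in> p n)"

text \<open>By compactness, finite additivity on cylinders already yields countable additivity.\<close>

lemma valuation_distribution:
  assumes P: "fin_add_probability W A P" and p: "range p \<subseteq> A"
  obtains M where "space M = UNIV" "sets M = sigma_sets UNIV cylinders"
    and "\<And>E. E \<in> cylinders \<Longrightarrow> emeasure M E = ennreal (P {w \<in> W. valuation p w \<in> E})"
proof -
  interpret A: algebra W A using P by (simp add: fin_add_probability_def)
  interpret C: algebra UNIV cylinders by (rule algebra_cylinders)
  define f where "f E = ennreal (P {w \<in> W. valuation p w \<in> E})" for E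
  have additive: "P (q \<union> r) = P q + P r" if "q \<in> A" "r \<in> A" "q \<inter> r = {}" for q r
    using P that by (auto simp: fin_add_probability_def additiveD)
  have nonneg: "0 \<le> P q" if "q \<in> A" for q
    using P that by (auto simp: fin_add_probability_def)
  have P_empty: "P {} = 0" using additive[of "{}" "{}"] by simp
  \<comment> \<open>\<open>P\<close> is only defined meaningfully on \<open>A\<close>, so preimages
    of cylinders under \<open>valuation p\<close> must be shown to lie there.\<close>
  have "algebra UNIV {E. {w \<in> W. valuation p w \<in> E} \<in> A}"
    unfolding algebra_iff_Un
  proof (intro conjI ballI)
    fix E assume E: "E \<in> {E. {w \<in> W. valuation p w \<in> E} \<in> A}"
    have eq: "{w \<in> W. valuation p w \<in> UNIV - E} = W - {w \<in> W. valuation p w \<in> E}" by auto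
    show "UNIV - E \<in> {E. {w \<in> W. valuation p w \<in> E} \<in> A}"
      using E unfolding mem_Collect_eq eq by (rule A.compl_sets)
    fix E' assume E': "E' \<in> {E. {w \<in> W. valuation p w \<in> E} \<in> A}"
    have eq': "{w \<in> W. valuation p w \<in> E \<union> E'} =
        {w \<in> W. valuation p w \<in> E} \<union> {w \<in> W. valuation p w \<in> E'}" by auto
    show "E \<union> E' \<in> {E. {w \<in> W. valuation p w \<in> E} \<in> A}"
      using E E' unfolding mem_Collect_eq eq' by (rule A.Un)
  qed simp_all
  moreover have "{w \<in> W. valuation p w \<in> {x. x n}} = p n" for n
    using p A.sets_into_space by (auto simp: valuation_def)
  then have "{x. x n} \<in> {E. {w \<in> W. valuation p w \<in> E} \<in> A}" for n
    using p by auto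
  ultimately have cyl: "{w \<in> W. valuation p w \<in> E} \<in> A" if "E \<in> cylinders" for E
    using cylinders_subset_algebra that by blast
  have "\<exists>\<mu>. (\<forall>E\<in>cylinders. \<mu> E = f E) \<and> measure_space UNIV (sigma_sets UNIV cylinders) \<mu>"
  proof (rule C.caratheodory_empty_continuous)
    show "positive cylinders f" by (simp add: positive_def f_def P_empty)
    show "Measure_Space.additive cylinders f"
      unfolding Measure_Space.additive_def
    proof (intro ballI impI)
      fix E E' assume E: "E \<in> cylinders" "E' \<in> cylinders" "E \<inter> E' = {}"
      have "{w \<in> W. valuation p w \<in> E \<union> E'} =
          {w \<in> W. valuation p w \<in> E} \<union> {w \<in> W. valuation p w \<in> E'}" by auto
      moreover have "P ({w \<in> W. valuation p w \<in> E} \<union> {w \<in> W. valuation p w \<in> E'}) =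
          P {w \<in> W. valuation p w \<in> E} + P {w \<in> W. valuation p w \<in> E'}"
        using cyl E by (intro additive) auto
      ultimately show "f (E \<union> E') = f E + f E'"
        using cyl E nonneg by (simp add: f_def)
    qed
    show "f E \<noteq> \<infinity>" for E by (simp add: f_def)
    fix E :: "nat \<Rightarrow> (nat \<Rightarrow> bool) set"
    assume E: "range E \<subseteq> cylinders" "decseq E" "(\<Inter>i. E i) = {}"
    \<comment> \<open>Nonempty decreasing closed sets in a compact space would have a common point,
      so the sequence reaches the empty set after finitely many steps.\<close>
    have "\<exists>i. E i = {}"
    proof (rule ccontr)
      assume ne: "\<nexists>i. E i = {}"
      have "UNIV \<inter> (\<Inter>i\<in>UNIV. E i) \<noteq> {}"
      proof (rule compact_imp_fip_image[OF compact_bool_sequences])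
        show "closed (E i)" for i using E(1) by (intro closed_cylinder) auto
        fix I :: "nat set" assume "finite I"
        then obtain N where "I \<subseteq> {..<N}" using finite_nat_iff_bounded by blast
        then have "E N \<subseteq> (\<Inter>i\<in>I. E i)"
          by (intro INF_greatest decseqD[OF E(2)]) auto
        then show "UNIV \<inter> (\<Inter>i\<in>I. E i) \<noteq> {}" using ne by blast
      qed
      with E(3) show False by simp
    qed
    then obtain i where "E i = {}" ..
    then have "E j = {}" if "i \<le> j" for j using decseqD[OF E(2) that] by simp
    moreover have "f {} = 0" by (simp add: f_def P_empty)
    ultimately have "\<forall>\<^sub>F j in sequentially. f (E j) = 0"
      unfolding eventually_sequentially by metis
    then show "(\<lambda>j. f (E j)) \<longlonglongrightarrow> 0" by (rule tendsto_eventually)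
  qed
  then obtain \<mu> where \<mu>: "\<And>E. E \<in> cylinders \<Longrightarrow> \<mu> E = f E"
    "measure_space UNIV (sigma_sets UNIV cylinders) \<mu>" by blast
  define M where "M = measure_of UNIV (sigma_sets UNIV cylinders) \<mu>"
  have sa: "sigma_algebra UNIV (sigma_sets UNIV cylinders)"
    by (rule sigma_algebra_sigma_sets) simp
  show thesis
  proof (rule that[of M])
    show "space M = UNIV" by (simp add: M_def space_measure_of_conv)
    show "sets M = sigma_sets UNIV cylinders"
      unfolding M_def by (rule sigma_algebra.sets_measure_of_eq[OF sa])
    show "emeasure M E = ennreal (P {w \<in> W. valuation p w \<in> E})" if E: "E \<in> cylinders" for E
    proof -
      have "emeasure M E = \<mu> E"
        unfolding M_def using \<mu>(2) E
        by (intro emeasure_measure_of_sigma) (auto simp: measure_space_def)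
      then show ?thesis using \<mu>(1)[OF E] by (simp add: f_def)
    qed
  qed
qed

section \<open>Limits of truth assignments and expected inaccuracy\<close>

definition limit_valuations :: "'w set \<Rightarrow> (nat \<Rightarrow> 'w set) \<Rightarrow> (nat \<Rightarrow> bool) set" where
  "limit_valuations W p = {x. \<forall>N. \<exists>w\<in>W. \<forall>n<N. x n = valuation p w n}"

definition score :: "(real \<Rightarrow> real \<Rightarrow> real) \<Rightarrow> (nat \<Rightarrow> real) \<Rightarrow> (nat \<Rightarrow> real) \<Rightarrow> (nat \<Rightarrow> bool) \<Rightarrow> ennreal" where
  "score \<dd> a y x = (\<Sum>i. ennreal (a i * \<dd> (of_bool (x i)) (y i)))"

lemma inaccuracy_eq_score: "inaccuracy \<dd> a p c w = score \<dd> a (c \<circ> p) (valuation p w)"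
  by (simp add: inaccuracy_def score_def valuation_def truth_value_def of_bool_def)

text \<open>\<open>limit_valuations\<close> is the closure of the truth assignments, and the score
  is lower semicontinuous: each partial sum at a limit point is also a partial sum at some
  world.\<close>

lemma score_le:
  assumes bound: "\<And>w. w \<in> W \<Longrightarrow> score \<dd> a y (valuation p w) \<le> C" and x: "x \<in> limit_valuations W p"
  shows "score \<dd> a y x \<le> C"
  unfolding score_def suminf_eq_SUP
proof (rule SUP_least)
  fix N
  obtain w where w: "w \<in> W" "\<And>n. n < N \<Longrightarrow> x n = valuation p w n"
    using x unfolding limit_valuations_def by blast
  have "(\<Sum>i<N. ennreal (a i * \<dd> (of_bool (x i)) (y i))) =
      (\<Sum>i<N. ennreal (a i * \<dd> (of_bool (valuation p w i)) (y i)))"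
    using w(2) by simp
  also have "\<dots> \<le> score \<dd> a y (valuation p w)"
    unfolding score_def by (intro sum_le_suminf) auto
  also have "\<dots> \<le> C" using w(1) by (rule bound)
  finally show "(\<Sum>i<N. ennreal (a i * \<dd> (of_bool (x i)) (y i))) \<le> C" .
qed

text \<open>The measure induced by \<open>P\<close> lives on the limit points. Propriety of each
  term compares the two expected scores one way; strict domination at all limit points would compare
  them strictly the other way.\<close>

lemma (in bregman) probability_not_dominated_on_limits:
  assumes P: "fin_add_probability W A P" and p: "range p \<subseteq> A" and a: "\<And>i. 0 < a i"
    and y: "\<And>i. y i \<in> {0..1}"
    and C: "C < \<infinity>" "\<And>x. x \<in> limit_valuations W p \<Longrightarrow> score \<dd> a (P \<circ> p) x \<le> C"
  shows "\<exists>x\<in>limit_valuations W p. score \<dd> a (P \<circ> p) x \<le> score \<dd> a y x"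
proof (rule ccontr)
  assume "\<not> ?thesis"
  then have less: "\<And>x. x \<in> limit_valuations W p \<Longrightarrow> score \<dd> a y x < score \<dd> a (P \<circ> p) x"
    by (auto simp: not_le)
  interpret A: algebra W A using P by (simp add: fin_add_probability_def)
  have additive: "P (q \<union> r) = P q + P r" if "q \<in> A" "r \<in> A" "q \<inter> r = {}" for q r
    using P that by (auto simp: fin_add_probability_def additiveD)
  obtain M where M: "space M = UNIV" "sets M = sigma_sets UNIV cylinders"
    "\<And>E. E \<in> cylinders \<Longrightarrow> emeasure M E = ennreal (P {w \<in> W. valuation p w \<in> E})"
    using valuation_distribution[OF P p] by metis
  have cyl_sets: "E \<in> sets M" if "E \<in> cylinders" for E using that M(2) by auto
  have PW: "P W = 1" using P by (simp add: fin_add_probability_def)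
  have P01: "P (p i) \<in> {0..1}" for i
    using P p fin_add_probability_le_1[OF P] by (auto simp: fin_add_probability_def)
  have M_UNIV: "emeasure M UNIV = 1"
    using M(3)[of UNIV] PW algebra.top[OF algebra_cylinders] by simp
  have coord: "{x. x i} \<in> sets M" "{x. \<not> x i} \<in> sets M"
    "emeasure M {x. x i} = ennreal (P (p i))" "emeasure M {x. \<not> x i} = ennreal (1 - P (p i))" for i
  proof -
    have neg: "{x. \<not> x i} \<in> cylinders" by (rule cylindersI[of "Suc i"]) auto
    show "{x. x i} \<in> sets M" "{x. \<not> x i} \<in> sets M"
      using neg coordinate_cylinder by (auto intro: cyl_sets)
    have sub: "p i \<subseteq> W" using p A.sets_into_space by blast
    have "{w \<in> W. valuation p w \<in> {x. x i}} = p i" "{w \<in> W. valuation p w \<in> {x. \<not> x i}} = W - p i"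
      using sub by (auto simp: valuation_def)
    moreover have "P (p i \<union> (W - p i)) = P (p i) + P (W - p i)"
      using p by (intro additive) auto
    then have "P (W - p i) = 1 - P (p i)"
      using sub PW by (simp add: Un_absorb1)
    ultimately show "emeasure M {x. x i} = ennreal (P (p i))" "emeasure M {x. \<not> x i} = ennreal (1 - P (p i))"
      using M(3)[OF neg] M(3)[OF coordinate_cylinder] by simp_all
  qed
  \<comment> \<open>The cylinder of sequences whose first \<open>N\<close> entries no world
    realises. No world is mapped into it, so it is null; the limit points are what remains after
    removing countably many such sets.\<close>
  define Z where "Z N = {x. \<not> (\<exists>w\<in>W. \<forall>n<N. x n = valuation p w n)}" for N
  have AE_limit: "AE x in M. x \<in> limit_valuations W p"
  proof -
    have "AE x in M. \<exists>w\<in>W. \<forall>n<N. x n = valuation p w n" for N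
    proof -
      have cyl: "Z N \<in> cylinders"
      proof (rule cylindersI[of N])
        fix x y :: "nat \<Rightarrow> bool" assume "\<And>n. n < N \<Longrightarrow> x n = y n"
        then have "(\<forall>n<N. x n = valuation p w n) \<longleftrightarrow> (\<forall>n<N. y n = valuation p w n)" for w by simp
        then show "x \<in> Z N \<longleftrightarrow>
            y \<in> Z N" unfolding Z_def by blast
      qed
      have "P {} = 0" using additive[of "{}" "{}"] by simp
      moreover have "{w \<in> W. valuation p w \<in> Z N} = {}"
        by (auto simp: Z_def)
      ultimately have "emeasure M (Z N) = 0"
        unfolding M(3)[OF cyl] by (simp only: ennreal_0)
      then show ?thesis
        using cyl_sets[OF cyl] by (intro AE_I[of _ _ "Z N"]) (auto simp: Z_def)
    qed
    then show ?thesis by (simp add: limit_valuations_def AE_all_countable)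
  qed
  \<comment> \<open>Each term takes only two values, so its integral is the two-point expectation
    appearing in \<open>proper\<close>.\<close>
  have term_eq: "ennreal (a i * \<dd> (of_bool (x i)) (z i)) =
      ennreal (a i * \<dd> 1 (z i)) * indicator {x. x i} x + ennreal (a i * \<dd> 0 (z i)) * indicator {x. \<not> x i} x"
    for i z and x :: "nat \<Rightarrow> bool"
    by (auto simp: indicator_def)
  have term_measurable: "(\<lambda>x. ennreal (a i * \<dd> (of_bool (x i)) (z i))) \<in> borel_measurable M" for i z
    unfolding term_eq using coord(1,2) by measurable
  have score_measurable: "score \<dd> a z \<in> borel_measurable M" for z
    unfolding score_def[abs_def] using term_measurable by measurable
  have integral: "(\<integral>\<^sup>+x. score \<dd> a z x \<partial>M) =
      (\<Sum>i. ennreal (a i * (P (p i) * \<dd> 1 (z i) + (1 - P (p i)) * \<dd> 0 (z i))))"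
    if z: "\<And>i. z i \<in> {0..1}" for z
  proof -
    have "(\<integral>\<^sup>+x. ennreal (a i * \<dd> (of_bool (x i)) (z i)) \<partial>M) =
        ennreal (a i * (P (p i) * \<dd> 1 (z i) + (1 - P (p i)) * \<dd> 0 (z i)))" for i
    proof -
      have "(\<integral>\<^sup>+x. ennreal (a i * \<dd> (of_bool (x i)) (z i)) \<partial>M) =
          ennreal (a i * \<dd> 1 (z i)) * ennreal (P (p i)) + ennreal (a i * \<dd> 0 (z i)) * ennreal (1 - P (p i))"
        unfolding term_eq using coord
        by (subst nn_integral_add) (auto simp: nn_integral_cmult_indicator)
      also have "\<dots> = ennreal (a i * \<dd> 1 (z i) * P (p i) + a i * \<dd> 0 (z i) * (1 - P (p i)))"
        using P01[of i] a[of i] nonneg[of 1 "z i"] nonneg[of 0 "z i"] z[of i]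
        by (simp flip: ennreal_mult ennreal_plus add: less_imp_le)
      also have "\<dots> = ennreal (a i * (P (p i) * \<dd> 1 (z i) + (1 - P (p i)) * \<dd> 0 (z i)))"
        by (simp add: algebra_simps)
      finally show ?thesis .
    qed
    then show ?thesis
      unfolding score_def by (subst nn_integral_suminf) (simp_all add: term_measurable)
  qed
  have "(\<integral>\<^sup>+x. score \<dd> a (P \<circ> p) x \<partial>M) \<le> (\<integral>\<^sup>+x. score \<dd> a y x \<partial>M)"
  proof -
    have "(\<integral>\<^sup>+x. score \<dd> a (P \<circ> p) x \<partial>M) =
        (\<Sum>i. ennreal (a i * (P (p i) * \<dd> 1 (P (p i)) + (1 - P (p i)) * \<dd> 0 (P (p i)))))"
      using integral[of "P \<circ> p"] P01 by simp
    also have "\<dots> \<le> (\<Sum>i. ennreal (a i * (P (p i) * \<dd> 1 (y i) + (1 - P (p i)) * \<dd> 0 (y i))))"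
      by (intro suminf_le ennreal_leI mult_left_mono proper P01 y less_imp_le a) auto
    also have "\<dots> = (\<integral>\<^sup>+x. score \<dd> a y x \<partial>M)" using integral[OF y] by simp
    finally show ?thesis .
  qed
  \<comment> \<open>A pointwise strict inequality passes to the integrals because the smaller one is
    finite, by the uniform bound \<open>C\<close>.\<close>
  moreover have "(\<integral>\<^sup>+x. score \<dd> a y x \<partial>M) < (\<integral>\<^sup>+x. score \<dd> a (P \<circ> p) x \<partial>M)"
  proof (rule nn_integral_less[OF score_measurable score_measurable])
    have "(\<integral>\<^sup>+x. score \<dd> a y x \<partial>M) \<le> (\<integral>\<^sup>+x. C \<partial>M)"
      using AE_limit by (intro nn_integral_mono_AE) (auto elim!: eventually_mono intro: less_imp_le less_le_trans less C(2))
    also have "\<dots> < \<infinity>" using C(1) M(1) M_UNIV by simp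
    finally show "(\<integral>\<^sup>+x. score \<dd> a y x \<partial>M) \<noteq> \<infinity>" by simp
    show "AE x in M. score \<dd> a y x \<le> score \<dd> a (P \<circ> p) x"
      using AE_limit by (auto elim!: eventually_mono dest!: less)
    show "\<not> (AE x in M. score \<dd> a (P \<circ> p) x \<le> score \<dd> a y x)"
    proof
      assume "AE x in M. score \<dd> a (P \<circ> p) x \<le> score \<dd> a y x"
      with AE_limit have "AE x in M. False"
        by eventually_elim (use less leD in blast)
      then have "emeasure M (space M) = 0" using AE_iff_measurable[of "space M" M "\<lambda>_. False"] by simp
      then show False using M(1) M_UNIV by simp
    qed
  qed
  ultimately show False by simp
qed

text \<open>A limit point is either the truth assignment of an old world or realised by none. In the
  latter case its sequence of signs has nonempty finite intersections but empty total intersection,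
  hence supplies a new point.\<close>

lemma limit_valuation_compact_world:
  assumes W: "W \<noteq> {}" and p: "inj p" "range p \<subseteq> Pow W" and x: "x \<in> limit_valuations W p"
  obtains w where "w \<in> compact_worlds W p"
    and "\<And>i. w \<in> \<Psi> W p (p i) \<longleftrightarrow> x i"
proof (cases "\<exists>w\<in>W. x = valuation p w")
  case True
  then obtain w where "w \<in> W" "x = valuation p w" by blast
  then show ?thesis
    by (intro that[of "Inl w"]) (auto simp: compact_worlds_def \<Psi>_def valuation_def)
next
  case False
  \<comment> \<open>Negated, since \<open>True\<close> selects the complement in
    \<open>signed_seq\<close>.\<close>
  define f where "f n = (\<not> x n)" for n
  have mem: "w \<in> signed_seq W p f n \<longleftrightarrow> x n = valuation p w n" if "w \<in> W" for w n
    using that by (auto simp: signed_seq_def f_def valuation_def)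
  have sub: "signed_seq W p f n \<subseteq> W" for n
    using p(2) by (auto simp: signed_seq_def)
  have "(\<Inter>n\<le>N. signed_seq W p f n) \<noteq> {}" for N
  proof -
    obtain w where "w \<in> W" "\<forall>n<Suc N. x n = valuation p w n"
      using x unfolding limit_valuations_def by blast
    then have "w \<in> (\<Inter>n\<le>N. signed_seq W p f n)" using mem by auto
    then show ?thesis by blast
  qed
  moreover have "(\<Inter>n. signed_seq W p f n) = {}"
  proof (rule ccontr)
    assume "(\<Inter>n. signed_seq W p f n) \<noteq> {}"
    then obtain w where w: "\<And>n. w \<in> signed_seq W p f n" by blast
    then have "w \<in> W" using sub by blast
    with w mem have "x = valuation p w" by blast
    with \<open>w \<in> W\<close> False show False by blast
  qed
  ultimately have new: "signed_seq W p f \<in> new_seqs W p"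
    unfolding new_seqs_def by blast
  \<comment> \<open>\<open>\<Psi>\<close> quantifies over all choice functions giving the sequence.
    The choice is unique because a subset of the nonempty \<open>W\<close> never equals its own
    complement.\<close>
  have inj: "g i = f i" if "signed_seq W p g = signed_seq W p f" for g i
  proof -
    have "signed_seq W p g i = signed_seq W p f i" using that by simp
    moreover have "p i \<noteq> W - p i" using W p(2) by blast
    ultimately show ?thesis by (auto simp: signed_seq_def split: if_splits)
  qed
  show ?thesis
  proof (rule that[of "Inr (signed_seq W p f)"])
    show "Inr (signed_seq W p f) \<in> compact_worlds W p"
      using new by (simp add: compact_worlds_def)
    fix i
    have "Inr (signed_seq W p f) \<in> \<Psi> W p (p i) \<longleftrightarrow>
        (\<exists>g. signed_seq W p g = signed_seq W p f \<and> \<not> g i)"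
      using new p(1) by (auto simp: \<Psi>_def inj_eq) metis+
    also have "\<dots> \<longleftrightarrow> x i" using inj by (auto simp: f_def)
    finally show "Inr (signed_seq W p f) \<in> \<Psi> W p (p i) \<longleftrightarrow> x i" .
  qed
qed

theorem theorem4p29:
  fixes W :: "'w set" and F :: "'w set set" and p :: "nat \<Rightarrow> 'w set"
    and \<dd> :: "real \<Rightarrow> real \<Rightarrow> real" and a :: "nat \<Rightarrow> real"
    and c :: "'w set \<Rightarrow> real"
  assumes "opinion_space W F"
    and "bij_betw p UNIV F"
    and "legitimate \<dd> a"
    and "S_stable W F p \<dd> a"
    and "\<And>b w. coherent W F b \<Longrightarrow> w \<in> W \<Longrightarrow> inaccuracy \<dd> a p b w < \<infinity>"
    and "credence F c"
  shows "coherent W F c \<longleftrightarrow> \<not> strongly_dominated W F (inaccuracy \<dd> a p) c"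
proof -
  have W: "W \<noteq> {}" and F: "F = range p" and p: "inj p" "range p \<subseteq> Pow W"
    using assms(1,2) by (auto simp: opinion_space_def bij_betw_def)
  have fin: "\<And>b w. coherent W (range p) b \<Longrightarrow> w \<in> W \<Longrightarrow> inaccuracy \<dd> a p b w < \<infinity>"
    and c: "credence (range p) c"
    using assms(5,6) F by auto
  have a: "\<And>i. 0 < a i" and d: "bounded_bregman_divergence \<dd>"
    using assms(3) by (auto simp: legitimate_def)
  from d obtain \<phi> \<phi>' B where "bregman \<dd> \<phi> \<phi>'"
    and B: "\<And>x y. x \<in> {0..1} \<Longrightarrow> y \<in> {0..1} \<Longrightarrow> \<dd> x y \<le> B"
    by (rule bounded_bregman_divergenceE) blast
  then interpret bregman \<dd> \<phi> \<phi>' by simp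
  have "\<not> strongly_dominated W F (inaccuracy \<dd> a p) c" if coherent: "coherent W F c"
  proof
    assume "strongly_dominated W F (inaccuracy \<dd> a p) c"
    with assms(4) coherent obtain e where e: "credence (\<Psi> W p ` F) e"
      and dom: "\<And>w. w \<in> compact_worlds W p \<Longrightarrow> inaccuracy \<dd> a (\<lambda>i. \<Psi> W p (p i)) e w
        < inaccuracy \<dd> a (\<lambda>i. \<Psi> W p (p i)) (star_credence W F p c) w"
      unfolding S_stable_def strongly_dominated_def strongly_dominates_def by blast
    obtain A P where AP: "F \<subseteq> A" "fin_add_probability W A P" "\<And>q. q \<in> F \<Longrightarrow> P q = c q"
      using coherent unfolding coherent_def by blast
    have Pp: "P \<circ> p = c \<circ> p" using AP(3) F by auto
    obtain w0 where w0: "w0 \<in> W" using W by blast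
    obtain M where M: "0 \<le> M" "\<And>w. w \<in> W \<Longrightarrow> disagreement a p w0 w \<le> ennreal M"
      using disagreement_bounded[OF w0 p(2) a fin[OF _ w0]] by blast
    \<comment> \<open>A bound on the inaccuracy of \<open>c\<close> uniform over the worlds;
      \<open>score_le\<close> carries it to all limit points.\<close>
    define C where "C = inaccuracy \<dd> a p c w0 + ennreal B * ennreal M"
    have "C < \<infinity>"
      using fin[of c, OF _ w0] coherent F by (simp add: C_def ennreal_mult_less_top)
    have "inaccuracy \<dd> a p c w \<le> C" if "w \<in> W" for w
    proof -
      have "inaccuracy \<dd> a p c w \<le> inaccuracy \<dd> a p c w0 + ennreal B * disagreement a p w0 w"
        by (rule inaccuracy_le_disagreement[OF B c a])
      also have "\<dots> \<le> C"
        unfolding C_def using M(2)[OF that] by (intro add_left_mono mult_left_mono) auto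
      finally show ?thesis .
    qed
    then have "score \<dd> a (P \<circ> p) (valuation p w) \<le> C" if "w \<in> W" for w
      using that by (simp only: Pp inaccuracy_eq_score)
    then have "score \<dd> a (P \<circ> p) x \<le> C" if "x \<in> limit_valuations W p" for x
      using score_le[OF _ that] by blast
    moreover have "e (\<Psi> W p (p i)) \<in> {0..1}" for i
      using e F by (auto simp: credence_def)
    ultimately obtain x where x: "x \<in> limit_valuations W p"
      and le: "score \<dd> a (P \<circ> p) x \<le> score \<dd> a (\<lambda>i. e (\<Psi> W p (p i))) x"
      using probability_not_dominated_on_limits[OF AP(2), of p a "\<lambda>i. e (\<Psi> W p (p i))" C]
        AP(1) F a \<open>C < \<infinity>\<close> by blast
    obtain w where w: "w \<in> compact_worlds W p" "\<And>i. w \<in> \<Psi> W p (p i) \<longleftrightarrow> x i"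
      using limit_valuation_compact_world[OF W p x] by blast
    \<comment> \<open>Read in the Cantor space, \<open>w\<close> becomes the point \<open>x\<close>
      and \<open>star_credence\<close> has the values of \<open>P\<close> along \<open>p\<close>, so
      domination at \<open>w\<close> contradicts \<open>le\<close>.\<close>
    have "valuation (\<lambda>i. \<Psi> W p (p i)) w = x" using w(2) by (auto simp: valuation_def)
    moreover have "star_credence W F p c \<circ> (\<lambda>i. \<Psi> W p (p i)) = P \<circ> p"
      using F AP(3) by (auto simp: star_credence_Psi)
    ultimately have "score \<dd> a (\<lambda>i. e (\<Psi> W p (p i))) x < score \<dd> a (P \<circ> p) x"
      using dom[OF w(1)] unfolding inaccuracy_eq_score by (simp add: comp_def)
    with le show False by simp
  qed
  moreover have "strongly_dominated W F (inaccuracy \<dd> a p) c" if "\<not> coherent W F c"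
    using incoherent_strongly_dominated[OF W p a B fin c] that F by simp
  ultimately show ?thesis by blast
qed

end
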